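(* Let $p_-<0<p_+$ and $\lambda_-,\lambda_+>0$. Let $(X,E)$ be the piecewise deterministic process on $\mathbb{R}\times I$, $I=\{-1,1\}$, obtained by switching between $f_{-1}(x)=p_-x-x^2$ and $f_1(x)=p_+x-x^2$, with constant rate $\lambda_-$ of switching from $f_{-1}$ to $f_1$ and constant rate $\lambda_+$ of switching from $f_1$ to $f_{-1}$. For $a<p_-$ let $\tau_a=\inf\{t\ge0: X_t\le a\}$. Let $\nu$ be a probability measure on $\mathbb{R}\times I$ with $\nu((-\infty,0)\times I)=1$, and let $\nu\mathsf{P}^{\tau_a}$ denote the law of $(X,E)$ with initial distribution $\nu$ and stopped at time $\tau_a$. Then there is a nondecreasing function $g:(-\infty,p_--2]\to(0,\infty)$ with $\int_{-\infty}^{p_--2}g(a)\,da<\infty$ such that for every $a\le p_--2$, $$\nu\mathsf{P}^{\tau_a}\left(\tau_{p_--1}<\infty\right)>0\qquad\text{and}\qquad \nu\mathsf{P}^{\tau_a}\left(\tau_a-\tau_{a+1}<g(a)\;\middle|\;\tau_{p_--1}<\infty\right)=1.$$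
   Context: The process $(X,E)$: $E=(E_t)_{t\ge0}$ is the continuous-time Markov chain on $I=\{-1,1\}$ that jumps from $-1$ to $1$ at rate $\lambda_-$ and from $1$ to $-1$ at rate $\lambda_+$ (rates independent of $X$), and $X$ solves $X_t=X_0+\int_0^t f_{E_s}(X_s)\,ds$. The vector fields are not forward complete (trajectories may go to $-\infty$ in finite time), but $(X,E)$ stopped at $\tau_a$, i.e. $(X_{t\wedge\tau_a},E_{t\wedge\tau_a})_{t\ge0}$, is well defined for all times. Convention: $\inf\emptyset=\infty$. *)

theory Defs
  imports "HOL-Probability.Probability"
begin

section \<open>The switched vector field\<close>

definition modes :: "int set" where
  "modes = {-1, 1}"

definition vfield :: "real \<Rightarrow> real \<Rightarrow> int \<Rightarrow> real \<Rightarrow> real" where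
  "vfield pm pp e x = (if e = -1 then pm else pp) * x - x\<^sup>2"

text \<open>
  Rate of leaving mode \<open>e\<close>: \<open>lm\<close> for the switch from \<open>-1\<close> to \<open>1\<close>, \<open>lp\<close> for the switch back.
\<close>
definition leave_rate :: "real \<Rightarrow> real \<Rightarrow> int \<Rightarrow> real" where
  "leave_rate lm lp e = (if e = -1 then lm else lp)"

definition state_space :: "(real \<times> int) measure" where
  "state_space = borel \<Otimes>\<^sub>M count_space modes"


section \<open>Hitting times and stopping\<close>

text \<open>
  Paths are functions on \<open>real\<close> of which only the restriction to \<open>{0..}\<close> matters.
  In \<open>ereal\<close> the infimum of the empty set is \<open>\<infinity>\<close>, and \<open>\<infinity> - \<infinity> = \<infinity>\<close>; so a bound
  \<open>hit a x - hit b x < ereal c\<close> can only hold if \<open>hit a x\<close> is finite.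
\<close>
definition hit :: "real \<Rightarrow> (real \<Rightarrow> real) \<Rightarrow> ereal" where
  "hit b x = (INF t\<in>{t. 0 \<le> t \<and> x t \<le> b}. ereal t)"

definition stopped :: "ereal \<Rightarrow> (real \<Rightarrow> 'b) \<Rightarrow> real \<Rightarrow> 'b" where
  "stopped \<tau> y t = y (real_of_ereal (min (ereal t) \<tau>))"


section \<open>Continuous-time Markov chain on the modes\<close>

text \<open>
  Time of the \<open>n\<close>-th jump of a chain started in mode \<open>e\<close>: the \<open>k\<close>-th mode visited is
  \<open>e * (-1) ^ k\<close>, and it is held for the time \<open>u k / leave_rate lm lp (e * (-1) ^ k)\<close>.
\<close>
definition jump_time :: "real \<Rightarrow> real \<Rightarrow> int \<Rightarrow> (nat \<Rightarrow> real) \<Rightarrow> nat \<Rightarrow> real" where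
  "jump_time lm lp e u n = (\<Sum>k<n. u k / leave_rate lm lp (e * (-1) ^ k))"

text \<open>
  \<open>E\<close> is the continuous-time Markov chain on the modes with the given jump rates, in the form
  jump chain plus holding times: for independent standard exponential \<open>\<xi> k\<close>, the holding time
  \<open>\<xi> k / r\<close> of a mode left at rate \<open>r\<close> is exponential with parameter \<open>r\<close>.
  The \<open>\<xi> k\<close> are independent of the initial datum \<open>Z\<close>, which determines \<open>E 0\<close> but may carry
  further information (below, the initial position); without this, \<open>Z\<close> could
  anticipate the later switches.  Both independence statements and the distribution of the
  \<open>\<xi> k\<close> are expressed by the joint law of \<open>(Z, \<xi>)\<close>.  Almost surely the jump times tend
  to infinity, so that the last conjunct describes \<open>E\<close> at all times.
\<close>
definition markov_switching ::
  "real \<Rightarrow> real \<Rightarrow> 'w measure \<Rightarrow> ('w \<Rightarrow> real \<times> int) \<Rightarrow> (real \<Rightarrow> 'w \<Rightarrow> int) \<Rightarrow> bool" where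
  "markov_switching lm lp M Z E \<longleftrightarrow>
     (\<forall>t\<ge>0. E t \<in> measurable M (count_space modes)) \<and>
     (\<forall>\<omega>\<in>space M. \<forall>t\<ge>0. continuous (at_right t) (\<lambda>s. E s \<omega>)) \<and>
     Z \<in> measurable M state_space \<and>
     (\<forall>\<omega>\<in>space M. snd (Z \<omega>) = E 0 \<omega>) \<and>
     (\<exists>\<xi> :: nat \<Rightarrow> 'w \<Rightarrow> real.
        (\<forall>n. \<xi> n \<in> borel_measurable M) \<and>
        distr M (state_space \<Otimes>\<^sub>M Pi\<^sub>M UNIV (\<lambda>_. borel)) (\<lambda>\<omega>. (Z \<omega>, \<lambda>n. \<xi> n \<omega>)) =
          distr M state_space Z \<Otimes>\<^sub>M Pi\<^sub>M UNIV (\<lambda>_. density lborel (exponential_density 1)) \<and>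
        (AE \<omega> in M. \<forall>n t.
           jump_time lm lp (E 0 \<omega>) (\<lambda>k. \<xi> k \<omega>) n \<le> t \<and>
           t < jump_time lm lp (E 0 \<omega>) (\<lambda>k. \<xi> k \<omega>) (Suc n) \<longrightarrow>
           E t \<omega> = E 0 \<omega> * (-1) ^ n))"


section \<open>The piecewise deterministic process up to a hitting time\<close>

text \<open>
  The vector fields are not forward complete, so the integral equation for \<open>X\<close> is imposed up to
  the hitting time of \<open>a\<close> only; afterwards \<open>X\<close> is an arbitrary continuous process, which is
  irrelevant for the stopped law below.
\<close>
definition switching_process_until ::
  "real \<Rightarrow> real \<Rightarrow> real \<Rightarrow> real \<Rightarrow> (real \<times> int) measure \<Rightarrow> real \<Rightarrow>
   'w measure \<Rightarrow> (real \<Rightarrow> 'w \<Rightarrow> real) \<Rightarrow> (real \<Rightarrow> 'w \<Rightarrow> int) \<Rightarrow> bool" where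
  "switching_process_until pm pp lm lp \<nu> a M X E \<longleftrightarrow>
     prob_space M \<and>
     distr M state_space (\<lambda>\<omega>. (X 0 \<omega>, E 0 \<omega>)) = \<nu> \<and>
     markov_switching lm lp M (\<lambda>\<omega>. (X 0 \<omega>, E 0 \<omega>)) E \<and>
     (\<forall>t\<ge>0. X t \<in> borel_measurable M) \<and>
     (\<forall>\<omega>\<in>space M. continuous_on {0..} (\<lambda>t. X t \<omega>)) \<and>
     (AE \<omega> in M. \<forall>t\<ge>0. ereal t \<le> hit a (\<lambda>s. X s \<omega>) \<longrightarrow>
        ((\<lambda>s. vfield pm pp (E s \<omega>) (X s \<omega>)) has_integral (X t \<omega> - X 0 \<omega>)) {0..t})"

text \<open>
  The restriction to regular paths is needed because hitting times are not measurable with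
  respect to the product sigma-algebra on the space of all paths.
\<close>
definition path_space :: "(real \<Rightarrow> real \<times> int) measure" where
  "path_space = restrict_space (Pi\<^sub>M {0..} (\<lambda>_. state_space))
     {w. continuous_on {0..} (\<lambda>t. fst (w t)) \<and>
         (\<forall>t\<ge>0. continuous (at_right t) (\<lambda>s. snd (w s)))}"

definition stopped_law ::
  "'w measure \<Rightarrow> (real \<Rightarrow> 'w \<Rightarrow> real) \<Rightarrow> (real \<Rightarrow> 'w \<Rightarrow> int) \<Rightarrow> real \<Rightarrow>
   (real \<Rightarrow> real \<times> int) measure" where
  "stopped_law M X E a = distr M path_space
     (\<lambda>\<omega>. \<lambda>t\<in>{0..}. stopped (hit a (\<lambda>s. X s \<omega>)) (\<lambda>s. (X s \<omega>, E s \<omega>)) t)"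

definition path_hit :: "real \<Rightarrow> (real \<Rightarrow> real \<times> int) \<Rightarrow> ereal" where
  "path_hit b w = hit b (\<lambda>t. fst (w t))"

end

theory Submission imports Defs begin

text \<open>
  On the negative half line both vector fields are bounded above by \<open>x * (pm - x)\<close>.  Below
  \<open>pm - 1/2\<close> this is negative of quadratic order, so once \<open>X\<close> is at most \<open>pm - 1\<close> it
  decreases whatever the switching, and descends from \<open>a + 1\<close> to \<open>a\<close> within time
  \<open>4 / (pm - 1 - a)\<^sup>2\<close>.  The constant 5 in place of 4 makes the bound strict.  For the positive
  probability, \<open>\<nu>\<close> charges \<open>{..- \<delta>} \<times> {e}\<close> for some \<open>\<delta> > 0\<close> and some mode \<open>e\<close>.
  From such a start, \<open>X\<close> stays below \<open>- \<delta> / 2\<close> for a short time in either mode, and a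
  sufficiently long stay in mode 1 entered during that time drives it below \<open>pm - 1\<close>.
\<close>

section \<open>Hitting times of continuous paths\<close>

lemma hit_nonneg: "0 \<le> hit b x"
  unfolding hit_def by (auto intro!: INF_greatest)

lemma hit_le:
  assumes "0 \<le> t" "x t \<le> b"
  shows "hit b x \<le> ereal t"
  unfolding hit_def using assms by (auto intro: INF_lower)

lemma hit_antimono:
  assumes "a \<le> b"
  shows "hit b x \<le> hit a x"
  unfolding hit_def using assms by (auto intro!: INF_superset_mono)

lemma hit_cong:
  assumes "\<And>t. 0 \<le> t \<Longrightarrow> x t = y t"
  shows "hit b x = hit b y"
  unfolding hit_def using assms by (metis (mono_tags, lifting) Collect_cong)

text \<open>The set of times spent at or below \<open>b\<close> is closed by continuity, bounded
  below by 0, and nonempty because the infimum over the empty set would be infinite; hence it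
  contains its infimum.\<close>

lemma hit_attained:
  assumes "continuous_on {0..} x" "hit b x < \<infinity>"
  obtains t where "0 \<le> t" "hit b x = ereal t" "x t \<le> b"
proof -
  define S where "S = {t. 0 \<le> t \<and> x t \<le> b}"
  have "S \<noteq> {}"
  proof
    assume "S = {}"
    then have "hit b x = \<infinity>"
      unfolding hit_def S_def[symmetric] by (simp add: top_ereal_def)
    with assms(2) show False by simp
  qed
  have "closed {t \<in> {0..}. x t \<le> b}"
    by (intro continuous_on_closed_Collect_le assms(1) continuous_intros)
  then have "closed S" unfolding S_def by (simp add: conj_commute)
  have bdd: "bdd_below S" unfolding S_def by (auto intro!: bdd_belowI[of _ 0])
  have "Inf S \<in> S"
    by (rule closed_contains_Inf) fact+
  moreover have "hit b x = ereal (Inf S)"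
  proof (rule antisym)
    show "hit b x \<le> ereal (Inf S)"
      using \<open>Inf S \<in> S\<close> unfolding S_def by (auto intro: hit_le)
    show "ereal (Inf S) \<le> hit b x"
      unfolding hit_def S_def[symmetric] using bdd by (auto intro!: INF_greatest cInf_lower)
  qed
  ultimately show thesis using that unfolding S_def by auto
qed

lemma hit_stopped:
  assumes "continuous_on {0..} x" "a \<le> b"
  shows "hit b (stopped (hit a x) x) = hit b x"
proof (rule antisym)
  let ?\<tau> = "hit a x"
  show "hit b (stopped ?\<tau> x) \<le> hit b x"
    unfolding hit_def[of b x]
  proof (rule INF_greatest)
    fix t assume "t \<in> {t. 0 \<le> t \<and> x t \<le> b}"
    then have t: "0 \<le> t" "x t \<le> b" by auto
    show "hit b (stopped ?\<tau> x) \<le> ereal t"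
    proof (cases "ereal t \<le> ?\<tau>")
      case True
      then show ?thesis using t by (intro hit_le) (auto simp: stopped_def min_def)
    next
      case False
      then have "?\<tau> < \<infinity>" by auto
      then obtain u where u: "0 \<le> u" "?\<tau> = ereal u" "x u \<le> a"
        by (rule hit_attained[OF assms(1)])
      then have "hit b (stopped ?\<tau> x) \<le> ereal u"
        using assms(2) by (intro hit_le) (auto simp: stopped_def min_def)
      also have "\<dots> \<le> ereal t" using False u by simp
      finally show ?thesis .
    qed
  qed
  show "hit b x \<le> hit b (stopped ?\<tau> x)"
    unfolding hit_def[of b "stopped ?\<tau> x"]
  proof (rule INF_greatest)
    fix t assume "t \<in> {t. 0 \<le> t \<and> stopped ?\<tau> x t \<le> b}"
    then have t: "0 \<le> t" "stopped ?\<tau> x t \<le> b" by auto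
    \<comment> \<open>The minimum lies between 0 and \<open>t\<close>, hence is finite, and
      \<open>real_of_ereal\<close> in \<open>stopped\<close> returns a genuine time rather than its
      default value.\<close>
    obtain r where r: "min (ereal t) ?\<tau> = ereal r"
    proof
      show "min (ereal t) ?\<tau> = ereal (real_of_ereal (min (ereal t) ?\<tau>))"
        using hit_nonneg[of a x] t(1) by (cases ?\<tau>) (auto simp: min_def)
    qed
    have "0 \<le> min (ereal t) ?\<tau>" using t(1) hit_nonneg[of a x] by simp
    then have "0 \<le> r" using r by simp
    have "ereal r \<le> ereal t" using r by (metis min.cobounded1)
    have "hit b x \<le> ereal r" using t(2) r \<open>0 \<le> r\<close> by (intro hit_le) (auto simp: stopped_def)
    also note \<open>ereal r \<le> ereal t\<close>
    finally show "hit b x \<le> ereal t" .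
  qed
qed

text \<open>By compactness, a continuous path reaches \<open>{..b}\<close> on \<open>{0..t}\<close> as soon as it comes
  arbitrarily close to it at rational fractions of \<open>t\<close>.\<close>

lemma hit_le_iff_rational:
  assumes "continuous_on {0..} x" "0 \<le> t"
  shows "hit b x \<le> ereal t \<longleftrightarrow>
    (\<forall>n. \<exists>q\<in>\<rat> \<inter> {0..1}. x (t * q) < b + inverse (real (Suc n)))"
proof
  assume le: "hit b x \<le> ereal t"
  then have "hit b x < \<infinity>" by (rule le_less_trans) simp
  then obtain s where s: "0 \<le> s" "hit b x = ereal s" "x s \<le> b"
    by (rule hit_attained[OF assms(1)])
  with le have "s \<le> t" by simp
  \<comment> \<open>Continuity of \<open>x\<close> is known on \<open>{0..}\<close> only. Clamping
    the fraction to \<open>[0, 1]\<close> gives a function continuous on the whole line, so its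
    strict sublevel sets are open.\<close>
  define c where "c r = max 0 (min 1 r)" for r :: real
  have cont: "continuous_on UNIV (\<lambda>r. x (t * c r))"
    unfolding c_def using assms(2)
    by (intro continuous_on_compose2[OF assms(1)] continuous_intros) auto
  show "\<forall>n. \<exists>q\<in>\<rat> \<inter> {0..1}. x (t * q) < b + inverse (real (Suc n))"
  proof
    fix n
    define y where "y = b + inverse (real (Suc n))"
    have "x s < y" using s unfolding y_def by (simp add: add_strict_increasing2 le_less_trans)
    \<comment> \<open>For \<open>t = 0\<close> the quotient is 0 by convention, which is harmless
      since then \<open>s = 0\<close> too.\<close>
    have ts: "t * c (s / t) = s"
      using s \<open>s \<le> t\<close> assms(2) by (cases "t = 0") (auto simp: c_def min_def max_def)
    have "open {r. x (t * c r) < y}"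
      using cont by (intro open_Collect_less) auto
    moreover have "s / t \<in> {r. x (t * c r) < y}" using ts \<open>x s < y\<close> by simp
    ultimately obtain e where e: "e > 0" "ball (s / t) e \<subseteq> {r. x (t * c r) < y}"
      by (metis openE)
    obtain q where q: "q \<in> \<rat>" "s / t < q" "q < s / t + e"
      using Rats_dense_in_real[of "s / t" "s / t + e"] e(1) by auto
    have "0 \<le> s / t" using s(1) assms(2) by simp
    with q have "0 < q" by linarith
    have "q \<in> ball (s / t) e" using q by (auto simp: dist_real_def)
    then have "x (t * c q) < y" using e(2) by auto
    \<comment> \<open>The rational \<open>q\<close> was chosen to the right of \<open>s / t\<close>
      and may exceed 1, but clamping preserves rationality.\<close>
    moreover have "c q \<in> \<rat> \<inter> {0..1}" using q(1) by (auto simp: c_def min_def max_def)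
    ultimately show "\<exists>q\<in>\<rat> \<inter> {0..1}. x (t * q) < b + inverse (real (Suc n))"
      unfolding y_def by blast
  qed
next
  assume R: "\<forall>n. \<exists>q\<in>\<rat> \<inter> {0..1}. x (t * q) < b + inverse (real (Suc n))"
  have "continuous_on {0..t} x" by (rule continuous_on_subset[OF assms(1)]) auto
  then obtain s where s: "s \<in> {0..t}" "\<And>r. r \<in> {0..t} \<Longrightarrow> x s \<le> x r"
    using continuous_attains_inf[of "{0..t}" x] assms(2) by auto
  have "x s \<le> b + inverse (real (Suc n))" for n
  proof -
    obtain q where q: "q \<in> {0..1}" "x (t * q) < b + inverse (real (Suc n))" using R by blast
    have "t * q \<in> {0..t}" using q(1) assms(2) by (auto simp: mult_left_le)
    with s(2) q(2) show ?thesis by (meson le_less_trans less_imp_le)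
  qed
  moreover have "(\<lambda>n. b + inverse (real (Suc n))) \<longlonglongrightarrow> b"
    using tendsto_add[OF tendsto_const LIMSEQ_inverse_real_of_nat, of b] by simp
  ultimately have "x s \<le> b" by (intro LIMSEQ_le_const) auto
  then have "hit b x \<le> ereal s" using s(1) by (intro hit_le) auto
  also have "\<dots> \<le> ereal t" using s(1) by simp
  finally show "hit b x \<le> ereal t" .
qed

text \<open>By the rational criterion, the event that the hitting time is at most a finite
  \<open>t\<close> is a countable intersection of countable unions of events at single times.
  Negative and infinite thresholds give the empty set and the whole space.\<close>

lemma measurable_hit:
  assumes meas: "\<And>t. 0 \<le> t \<Longrightarrow> Y t \<in> borel_measurable N"
    and cont: "\<And>\<omega>. \<omega> \<in> space N \<Longrightarrow> continuous_on {0..} (\<lambda>t. Y t \<omega>)"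
  shows "(\<lambda>\<omega>. hit b (\<lambda>t. Y t \<omega>)) \<in> borel_measurable N"
  unfolding borel_measurable_iff_Iic_ereal
proof
  fix c :: ereal
  show "(\<lambda>\<omega>. hit b (\<lambda>t. Y t \<omega>)) -` {..c} \<inter> space N \<in> sets N"
  proof (cases "0 \<le> c")
    case False
    then have "(\<lambda>\<omega>. hit b (\<lambda>t. Y t \<omega>)) -` {..c} \<inter> space N = {}"
      using hit_nonneg order_trans by fastforce
    then show ?thesis by simp
  next
    case True
    then show ?thesis
    proof (cases c)
      case (real t)
      with True have "0 \<le> t" by simp
      have "(\<lambda>\<omega>. hit b (\<lambda>t. Y t \<omega>)) -` {..c} \<inter> space N =
        (\<Inter>n. \<Union>q\<in>\<rat> \<inter> {0..1}. {\<omega> \<in> space N. Y (t * q) \<omega> < b + inverse (real (Suc n))})"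
        using hit_le_iff_rational[OF cont \<open>0 \<le> t\<close>, of _ b] real by auto
      also have "\<dots> \<in> sets N"
      proof (intro sets.countable_INT image_subsetI sets.countable_UN'')
        show "countable (\<rat> \<inter> {0..1} :: real set)" by (simp add: countable_rat)
        fix n and q :: real
        assume "q \<in> \<rat> \<inter> {0..1}"
        then have [measurable]: "Y (t * q) \<in> borel_measurable N"
          using \<open>0 \<le> t\<close> by (intro meas) auto
        show "{\<omega> \<in> space N. Y (t * q) \<omega> < b + inverse (real (Suc n))} \<in> sets N" by measurable
      qed auto
      finally show ?thesis .
    next
      case PInf
      then have "(\<lambda>\<omega>. hit b (\<lambda>t. Y t \<omega>)) -` {..c} \<inter> space N = space N" by auto
      then show ?thesis by simp
    qed (use True in auto)
  qed
qed


section \<open>Stopped right-continuous processes\<close>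

text \<open>The random time is approximated from the right by grid times. Each approximation takes
  countably many values, so the process evaluated there is measurable, and right continuity passes
  this to the limit.\<close>

lemma measurable_right_continuous_at_random_time:
  fixes Y :: "real \<Rightarrow> 'w \<Rightarrow> 'b :: metric_space"
  assumes meas: "\<And>t. 0 \<le> t \<Longrightarrow> Y t \<in> borel_measurable M"
    and cont: "\<And>\<omega> t. \<omega> \<in> space M \<Longrightarrow> 0 \<le> t \<Longrightarrow> continuous (at_right t) (\<lambda>s. Y s \<omega>)"
    and \<sigma>: "\<sigma> \<in> borel_measurable M" "\<And>\<omega>. \<omega> \<in> space M \<Longrightarrow> 0 \<le> \<sigma> \<omega>"
  shows "(\<lambda>\<omega>. Y (\<sigma> \<omega>) \<omega>) \<in> borel_measurable M"
proof (rule borel_measurable_LIMSEQ_metric)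
  \<comment> \<open>The quotient of \<open>Suc (k n \<omega>)\<close> by \<open>Suc n\<close> is the
    first point of the grid of mesh \<open>1 / Suc n\<close> strictly after
    \<open>\<sigma> \<omega>\<close>. Strictness is what convergence along \<open>at_right\<close>
    requires.\<close>
  define k where "k n \<omega> = nat \<lfloor>real (Suc n) * \<sigma> \<omega>\<rfloor>" for n \<omega>
  have k_meas [measurable]: "k n \<in> measurable M (count_space UNIV)" for n
    unfolding k_def using \<sigma>(1) by measurable
  show "(\<lambda>\<omega>. Y (real (Suc (k n \<omega>)) / real (Suc n)) \<omega>) \<in> borel_measurable M" for n
    by (rule measurable_compose_countable[where g = "k n"]) (auto intro!: meas)
  fix \<omega> assume \<omega>: "\<omega> \<in> space M"
  have bounds: "\<sigma> \<omega> < real (Suc (k n \<omega>)) / real (Suc n)"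
    "real (Suc (k n \<omega>)) / real (Suc n) \<le> \<sigma> \<omega> + inverse (real (Suc n))" for n
  proof -
    have "0 \<le> real (Suc n) * \<sigma> \<omega>" using \<sigma>(2)[OF \<omega>] by simp
    then have "real (k n \<omega>) \<le> real (Suc n) * \<sigma> \<omega>" "real (Suc n) * \<sigma> \<omega> < real (k n \<omega>) + 1"
      unfolding k_def by linarith+
    then have *: "real (k n \<omega>) / real (Suc n) \<le> \<sigma> \<omega>" "\<sigma> \<omega> < (real (k n \<omega>) + 1) / real (Suc n)"
      by (simp_all only: pos_divide_le_eq pos_less_divide_eq of_nat_0_less_iff zero_less_Suc mult.commute)
    then show "\<sigma> \<omega> < real (Suc (k n \<omega>)) / real (Suc n)" by (simp add: add.commute)
    show "real (Suc (k n \<omega>)) / real (Suc n) \<le> \<sigma> \<omega> + inverse (real (Suc n))"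
      using *(1) by (simp add: add_divide_distrib inverse_eq_divide)
  qed
  have "(\<lambda>n. real (Suc (k n \<omega>)) / real (Suc n)) \<longlonglongrightarrow> \<sigma> \<omega>"
  proof (rule tendsto_sandwich[where f = "\<lambda>_. \<sigma> \<omega>" and h = "\<lambda>n. \<sigma> \<omega> + inverse (real (Suc n))"])
    show "(\<lambda>n. \<sigma> \<omega> + inverse (real (Suc n))) \<longlonglongrightarrow> \<sigma> \<omega>"
      using tendsto_add[OF tendsto_const LIMSEQ_inverse_real_of_nat, of "\<sigma> \<omega>"] by simp
    show "eventually (\<lambda>n. \<sigma> \<omega> \<le> real (Suc (k n \<omega>)) / real (Suc n)) sequentially"
      using bounds(1) by (intro always_eventually allI less_imp_le)
    show "eventually (\<lambda>n. real (Suc (k n \<omega>)) / real (Suc n) \<le> \<sigma> \<omega> + inverse (real (Suc n))) sequentially"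
      using bounds(2) by (intro always_eventually allI)
  qed simp
  then have "filterlim (\<lambda>n. real (Suc (k n \<omega>)) / real (Suc n)) (at_right (\<sigma> \<omega>)) sequentially"
    using bounds(1) unfolding filterlim_at
    by (intro conjI always_eventually allI) (simp_all only: greaterThan_iff less_imp_neq[symmetric] simp_thms)
  then show "(\<lambda>n. Y (real (Suc (k n \<omega>)) / real (Suc n)) \<omega>) \<longlonglongrightarrow> Y (\<sigma> \<omega>) \<omega>"
    using cont[OF \<omega> \<sigma>(2)[OF \<omega>]] unfolding continuous_within by (rule filterlim_compose[rotated])
qed

lemma real_of_ereal_min_nonneg:
  assumes "0 \<le> t" "0 \<le> \<tau>"
  shows "0 \<le> real_of_ereal (min (ereal t) \<tau>)"
  using assms by (cases \<tau>) (simp_all add: min_def)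

text \<open>Immediately to the right of \<open>t\<close> the stopped path agrees with
  \<open>y\<close> if \<open>t\<close> is before \<open>\<tau>\<close>, and is constant
  otherwise.\<close>

lemma continuous_at_right_stopped:
  assumes "\<And>t. 0 \<le> t \<Longrightarrow> continuous (at_right t) y" "0 \<le> t" "0 \<le> \<tau>"
  shows "continuous (at_right t) (stopped \<tau> y)"
proof (cases "ereal t < \<tau>")
  case True
  then obtain u where u: "t < u" "ereal u \<le> \<tau>"
    by (metis ereal_dense2 ereal_less(2) less_imp_le less_ereal.simps(1))
  have "eventually (\<lambda>s. s \<in> {t<..<u}) (at_right t)"
    using u by (auto simp: eventually_at_right_field)
  then have ev: "eventually (\<lambda>s. stopped \<tau> y s = y s) (at_right t)"
  proof eventually_elim
    case (elim s)
    then have "ereal s \<le> ereal u" by simp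
    also note u(2)
    finally show ?case by (simp add: stopped_def min_def)
  qed
  have "stopped \<tau> y t = y t" using True by (simp add: stopped_def min_def less_imp_le)
  moreover have "(y \<longlongrightarrow> y t) (at_right t)" using assms(1,2) by (simp add: continuous_within)
  ultimately show ?thesis
    unfolding continuous_within using tendsto_cong[OF ev, of "y t"] by simp
next
  case False
  have "eventually (\<lambda>s. s \<in> {t<..<t+1}) (at_right t)"
    by (rule eventually_at_right_real) simp
  then have "eventually (\<lambda>s. stopped \<tau> y s = stopped \<tau> y t) (at_right t)"
  proof eventually_elim
    case (elim s)
    then have "ereal t \<le> ereal s" by simp
    with False have "\<tau> \<le> ereal s" by (meson not_less order_trans)
    with False show ?case by (simp add: stopped_def min_def antisym)
  qed
  then show ?thesis
    unfolding continuous_within by (rule tendsto_eventually)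
qed

lemma continuous_on_stopped:
  assumes "continuous_on {0..} y" "0 \<le> \<tau>"
  shows "continuous_on {0..} (stopped \<tau> y)"
proof (cases \<tau>)
  case (real u)
  have "continuous_on {0..} (\<lambda>t. y (min t u))"
    using real assms(2) by (intro continuous_on_compose2[OF assms(1)] continuous_intros) auto
  moreover have "stopped \<tau> y t = y (min t u)" for t
    unfolding stopped_def real by (simp add: min_def)
  ultimately show ?thesis by simp
next
  case PInf
  then show ?thesis unfolding stopped_def using assms(1) by (simp add: min_def)
qed (use assms in auto)

section \<open>The stopped process as a random element of the path space\<close>

definition stopped_path ::
  "(real \<Rightarrow> 'w \<Rightarrow> real) \<Rightarrow> (real \<Rightarrow> 'w \<Rightarrow> int) \<Rightarrow> real \<Rightarrow> 'w \<Rightarrow> real \<Rightarrow> real \<times> int" where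
  "stopped_path X E a \<omega> =
     (\<lambda>t\<in>{0..}. stopped (hit a (\<lambda>s. X s \<omega>)) (\<lambda>s. (X s \<omega>, E s \<omega>)) t)"

lemma stopped_path_apply:
  assumes "0 \<le> t"
  shows "stopped_path X E a \<omega> t =
    (stopped (hit a (\<lambda>s. X s \<omega>)) (\<lambda>s. X s \<omega>) t, stopped (hit a (\<lambda>s. X s \<omega>)) (\<lambda>s. E s \<omega>) t)"
  using assms by (simp add: stopped_path_def stopped_def)

lemma path_hit_stopped_path:
  assumes "continuous_on {0..} (\<lambda>t. X t \<omega>)" "a \<le> b"
  shows "path_hit b (stopped_path X E a \<omega>) = hit b (\<lambda>t. X t \<omega>)"
proof -
  have "path_hit b (stopped_path X E a \<omega>) =
      hit b (stopped (hit a (\<lambda>t. X t \<omega>)) (\<lambda>t. X t \<omega>))"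
    unfolding path_hit_def by (rule hit_cong) (simp add: stopped_path_apply)
  then show ?thesis using hit_stopped[OF assms] by simp
qed

text \<open>Evaluations at fixed times are measurable for the product sigma-algebra, and the
  restriction to regular paths supplies the continuity that \<open>measurable_hit\<close> asks
  for.\<close>

lemma measurable_path_hit [measurable]: "path_hit b \<in> borel_measurable path_space"
proof -
  have "(\<lambda>w. hit b (\<lambda>t. fst (w t))) \<in> borel_measurable path_space"
  proof (rule measurable_hit)
    fix t :: real assume "0 \<le> t"
    then have "(\<lambda>w. w t) \<in> measurable (Pi\<^sub>M {0..} (\<lambda>_. state_space)) state_space"
      by (intro measurable_component_singleton) auto
    then have "(\<lambda>w. w t) \<in> measurable path_space state_space"
      unfolding path_space_def by (rule measurable_restrict_space1)
    moreover have "fst \<in> borel_measurable state_space"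
      unfolding state_space_def by measurable
    ultimately show "(\<lambda>w. fst (w t)) \<in> borel_measurable path_space"
      by (rule measurable_compose)
  qed (auto simp: path_space_def space_restrict_space)
  then show ?thesis unfolding path_hit_def .
qed

text \<open>Each coordinate is the process evaluated at the random time \<open>min t \<tau>\<close>,
  hence measurable by right continuity; since stopping preserves path regularity, the values lie in
  the restricted space.\<close>

lemma measurable_stopped_path:
  assumes X: "\<And>t. 0 \<le> t \<Longrightarrow> X t \<in> borel_measurable M"
      "\<And>\<omega>. \<omega> \<in> space M \<Longrightarrow> continuous_on {0..} (\<lambda>t. X t \<omega>)"
    and E: "\<And>t. 0 \<le> t \<Longrightarrow> E t \<in> measurable M (count_space modes)"
      "\<And>\<omega> t. \<omega> \<in> space M \<Longrightarrow> 0 \<le> t \<Longrightarrow> continuous (at_right t) (\<lambda>s. E s \<omega>)"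
  shows "stopped_path X E a \<in> measurable M path_space"
proof -
  define \<tau> where "\<tau> \<omega> = hit a (\<lambda>s. X s \<omega>)" for \<omega>
  have [measurable]: "\<tau> \<in> borel_measurable M"
    unfolding \<tau>_def by (rule measurable_hit[OF X])
  have \<tau>_nonneg: "0 \<le> \<tau> \<omega>" for \<omega> unfolding \<tau>_def by (rule hit_nonneg)
  define \<sigma> where "\<sigma> t \<omega> = real_of_ereal (min (ereal t) (\<tau> \<omega>))" for t \<omega>
  have \<sigma>_meas: "\<sigma> t \<in> borel_measurable M" for t
    unfolding \<sigma>_def by measurable
  have \<sigma>_nonneg: "0 \<le> \<sigma> t \<omega>" if "0 \<le> t" for t \<omega>
    unfolding \<sigma>_def by (rule real_of_ereal_min_nonneg) (use that \<tau>_nonneg in auto)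
  have X_right: "continuous (at_right t) (\<lambda>s. X s \<omega>)" if "\<omega> \<in> space M" "0 \<le> t" for \<omega> t
  proof -
    have "continuous (at t within {0..}) (\<lambda>s. X s \<omega>)"
      using X(2)[OF that(1)] that(2) by (simp add: continuous_on_eq_continuous_within)
    then show ?thesis by (rule continuous_within_subset) (use that in auto)
  qed
  have eq: "stopped_path X E a \<omega> = (\<lambda>t\<in>{0..}. (X (\<sigma> t \<omega>) \<omega>, E (\<sigma> t \<omega>) \<omega>))" for \<omega>
    by (auto simp: stopped_path_def stopped_def \<sigma>_def \<tau>_def fun_eq_iff)
  have "stopped_path X E a \<in> measurable M (Pi\<^sub>M {0..} (\<lambda>_. state_space))"
    unfolding eq
  proof (rule measurable_restrict)
    fix t :: real assume "t \<in> {0..}"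
    then have t: "0 \<le> t" by simp
    have "(\<lambda>\<omega>. X (\<sigma> t \<omega>) \<omega>) \<in> borel_measurable M"
      by (rule measurable_right_continuous_at_random_time[OF X(1) X_right \<sigma>_meas \<sigma>_nonneg[OF t]])
    moreover have "(\<lambda>\<omega>. E (\<sigma> t \<omega>) \<omega>) \<in> measurable M (count_space modes)"
    proof (subst measurable_count_space_eq2_countable, intro conjI ballI)
      show "(\<lambda>\<omega>. E (\<sigma> t \<omega>) \<omega>) \<in> space M \<rightarrow> modes"
        using measurable_space[OF E(1)[OF \<sigma>_nonneg[OF t]]] by auto
      fix e assume "e \<in> modes"
      \<comment> \<open>The mode is viewed as a real number to bring it under the Borel-valued
        evaluation lemma. Right continuity survives because in a discrete space it means being
        constant just after each time.\<close>
      have "(\<lambda>\<omega>. real_of_int (E (\<sigma> t \<omega>) \<omega>)) \<in> borel_measurable M"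
      proof (rule measurable_right_continuous_at_random_time[where Y = "\<lambda>s \<omega>. real_of_int (E s \<omega>)"])
        show "(\<lambda>\<omega>. real_of_int (E s \<omega>)) \<in> borel_measurable M" if "0 \<le> s" for s
          using measurable_compose[OF E(1)[OF that], of real_of_int borel] by simp
        show "continuous (at_right s) (\<lambda>s. real_of_int (E s \<omega>))"
          if "\<omega> \<in> space M" "0 \<le> s" for \<omega> s
          using E(2)[OF that] unfolding continuous_within tendsto_discrete
          by (intro tendsto_eventually) (auto elim: eventually_mono)
      qed (use \<sigma>_meas \<sigma>_nonneg[OF t] in auto)
      then have "(\<lambda>\<omega>. real_of_int (E (\<sigma> t \<omega>) \<omega>)) -` {real_of_int e} \<inter> space M \<in> sets M"
        by (rule measurable_sets) simp
      then show "(\<lambda>\<omega>. E (\<sigma> t \<omega>) \<omega>) -` {e} \<inter> space M \<in> sets M"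
        by (simp add: vimage_def)
    qed
    ultimately show "(\<lambda>\<omega>. (X (\<sigma> t \<omega>) \<omega>, E (\<sigma> t \<omega>) \<omega>)) \<in> measurable M state_space"
      unfolding state_space_def by (rule measurable_Pair)
  qed
  moreover have "continuous_on {0..} (\<lambda>t. fst (stopped_path X E a \<omega> t)) \<and>
      (\<forall>t\<ge>0. continuous (at_right t) (\<lambda>s. snd (stopped_path X E a \<omega> s)))"
    if \<omega>: "\<omega> \<in> space M" for \<omega>
  proof (intro conjI allI impI)
    have "continuous_on {0..} (stopped (\<tau> \<omega>) (\<lambda>t. X t \<omega>))"
      by (rule continuous_on_stopped[OF X(2)[OF \<omega>] \<tau>_nonneg])
    then show "continuous_on {0..} (\<lambda>t. fst (stopped_path X E a \<omega> t))"
      by (rule continuous_on_eq) (simp add: stopped_path_apply \<tau>_def)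
    fix t :: real assume t: "0 \<le> t"
    have "continuous (at_right t) (stopped (\<tau> \<omega>) (\<lambda>t. E t \<omega>))"
      by (rule continuous_at_right_stopped[OF E(2)[OF \<omega>] t \<tau>_nonneg])
    moreover have "eventually (\<lambda>s. snd (stopped_path X E a \<omega> s) = stopped (\<tau> \<omega>) (\<lambda>t. E t \<omega>) s) (at_right t)"
      using t by (auto simp: eventually_at_filter stopped_path_apply \<tau>_def intro!: always_eventually)
    ultimately show "continuous (at_right t) (\<lambda>s. snd (stopped_path X E a \<omega> s))"
      unfolding continuous_within using t
      by (subst tendsto_cong) (auto simp: stopped_path_apply \<tau>_def)
  qed
  ultimately show ?thesis
    unfolding path_space_def by (intro measurable_restrict_space2) auto
qed


section \<open>Descent of the switched flow\<close>

text \<open>A first-exit argument: the bound on \<open>h\<close> is available only while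
  \<open>x\<close> is at most \<open>b\<close>. Were \<open>x\<close> to exceed \<open>b\<close>,
  integrating up to the first time it equals \<open>b\<close> would give a value below
  \<open>b\<close> by the condition on the start. The term \<open>max c 0\<close> lets this
  condition serve for either sign of \<open>c\<close>.\<close>

lemma integral_curve_bound:
  fixes x h :: "real \<Rightarrow> real"
  assumes cont: "continuous_on {s..t} x"
    and int: "\<And>u. u \<in> {s..t} \<Longrightarrow> (h has_integral (x u - x s)) {s..u}"
    and bd: "\<And>r. r \<in> {s..t} \<Longrightarrow> x r \<le> b \<Longrightarrow> h r \<le> c"
    and start: "x s + max c 0 * (t - s) < b" and st: "s \<le> t"
  shows "x t \<le> x s + c * (t - s)"
proof -
  have le: "x u \<le> x s + c * (u - s)"
    if u: "u \<in> {s..t}" and below: "\<And>r. r \<in> {s..u} \<Longrightarrow> x r \<le> b" for u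
  proof -
    have "((\<lambda>_. c) has_integral (c * (u - s))) {s..u}"
      using has_integral_const_real[of c s u] u by (simp add: mult.commute)
    from has_integral_le[OF int[OF u] this] have "x u - x s \<le> c * (u - s)"
      using bd below u by auto
    then show ?thesis by simp
  qed
  have "x r \<le> b" if r: "r \<in> {s..t}" for r
  proof (rule ccontr)
    assume "\<not> x r \<le> b"
    \<comment> \<open>The infimum \<open>v\<close> of this closed set is the first time at level
      \<open>b\<close>; on \<open>{s..v}\<close> the estimate \<open>le\<close> already
      applies.\<close>
    define S where "S = {u \<in> {s..t}. b \<le> x u}"
    have "closed S" unfolding S_def by (intro continuous_on_closed_Collect_le cont continuous_intros)
    moreover have "S \<noteq> {}" using r \<open>\<not> x r \<le> b\<close> by (auto simp: S_def)
    moreover have bdd: "bdd_below S" by (auto simp: S_def intro!: bdd_belowI[of _ s])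
    ultimately have inS: "Inf S \<in> S" by (intro closed_contains_Inf)
    define v where "v = Inf S"
    have v: "s \<le> v" "v \<le> t" "b \<le> x v" using inS by (auto simp: S_def v_def)
    have before: "x r < b" if "r \<in> {s..<v}" for r
    proof (rule ccontr)
      assume "\<not> x r < b"
      then have "r \<in> S" using that v by (auto simp: S_def)
      then show False using cInf_lower[OF _ bdd] that unfolding v_def by force
    qed
    have "x v = b"
    proof (rule ccontr)
      assume "x v \<noteq> b"
      with v have "b < x v" by simp
      have "0 \<le> max c 0 * (t - s)" using st by simp
      then have "x s \<le> b" using start by linarith
      have "continuous_on {s..v} x" by (rule continuous_on_subset[OF cont]) (use v in auto)
      then obtain r where "s \<le> r" "r \<le> v" "x r = b"
        using IVT'[of x s b v] \<open>b < x v\<close> \<open>x s \<le> b\<close> v by auto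
      then show False using before[of r] \<open>x v \<noteq> b\<close> by (cases "r = v") auto
    qed
    have "x v \<le> x s + c * (v - s)"
    proof (rule le)
      show "x r \<le> b" if "r \<in> {s..v}" for r
        using before[of r] \<open>x v = b\<close> that by (cases "r = v") auto
    qed (use v in auto)
    \<comment> \<open>Passing to \<open>max c 0\<close> permits enlarging \<open>v - s\<close> to
      \<open>t - s\<close> even for negative \<open>c\<close>.\<close>
    also have "c * (v - s) \<le> max c 0 * (t - s)"
      using v by (intro mult_mono) auto
    finally show False using start \<open>x v = b\<close> by simp
  qed
  then show ?thesis using st by (intro le) auto
qed

text \<open>This is what almost every outcome of the process satisfies; it separates the
  deterministic estimates from the probability.\<close>

definition solves_until :: "real \<Rightarrow> real \<Rightarrow> real \<Rightarrow> (real \<Rightarrow> real) \<Rightarrow> (real \<Rightarrow> int) \<Rightarrow> bool" where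
  "solves_until pm pp a x e \<longleftrightarrow> continuous_on {0..} x \<and>
     (\<forall>t\<ge>0. ereal t \<le> hit a x \<longrightarrow>
        ((\<lambda>s. vfield pm pp (e s) (x s)) has_integral (x t - x 0)) {0..t})"

text \<open>Subtracting the integral equations at \<open>u\<close> and at \<open>s\<close>, both
  valid up to the hitting time of \<open>a\<close>, restarts the equation at \<open>s\<close>, so
  that \<open>integral_curve_bound\<close> applies.\<close>

lemma solves_until_bound:
  assumes sol: "solves_until pm pp a x e"
    and t: "0 \<le> s" "s \<le> t" "ereal t \<le> hit a x"
    and bd: "\<And>r. r \<in> {s..t} \<Longrightarrow> x r \<le> b \<Longrightarrow> vfield pm pp (e r) (x r) \<le> c"
    and start: "x s + max c 0 * (t - s) < b"
  shows "x t \<le> x s + c * (t - s)"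
proof (rule integral_curve_bound[where h = "\<lambda>r. vfield pm pp (e r) (x r)" and b = b])
  show "continuous_on {s..t} x"
    using sol t(1) by (auto simp: solves_until_def elim!: continuous_on_subset)
  fix u assume u: "u \<in> {s..t}"
  let ?h = "\<lambda>r. vfield pm pp (e r) (x r)"
  have hit: "ereal u \<le> hit a x" "ereal s \<le> hit a x"
    using u t by (auto intro: order_trans[of _ "ereal t"])
  then have I: "(?h has_integral (x u - x 0)) {0..u}" "(?h has_integral (x s - x 0)) {0..s}"
    using sol t u by (auto simp: solves_until_def)
  then have "integral {0..s} ?h + integral {s..u} ?h = integral {0..u} ?h"
    using u t by (intro Henstock_Kurzweil_Integration.integral_combine) (auto simp: has_integral_integrable)
  moreover have "integral {0..s} ?h = x s - x 0" "integral {0..u} ?h = x u - x 0"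
    using I by (auto intro: integral_unique)
  moreover have "?h integrable_on {s..u}"
    using integrable_subinterval_real[OF has_integral_integrable[OF I(1)], of s u] u t by auto
  ultimately show "(?h has_integral (x u - x s)) {s..u}"
    by (simp add: has_integral_integral[symmetric] has_integral_iff)
qed (use assms in auto)

text \<open>For \<open>x \<le> 0\<close> one has \<open>pp * x \<le> 0 \<le> pm * x\<close>, so the
  field of mode -1 is the larger one.\<close>

lemma vfield_le_of_nonpos:
  assumes "pm < 0" "0 < pp" "x \<le> 0"
  shows "vfield pm pp e x \<le> x * (pm - x)"
proof -
  have "pp * x \<le> 0" "0 \<le> pm * x" using assms by (auto simp: mult_nonneg_nonpos mult_nonpos_nonpos)
  then show ?thesis by (simp add: vfield_def algebra_simps power2_eq_square)
qed

text \<open>Near and below level \<open>b\<close> the path falls at speed at least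
  \<open>d\<^sup>2 / 4\<close> in either mode, so the height \<open>b - a\<close> is covered in time
  \<open>4 * (b - a) / d\<^sup>2\<close>. If \<open>a\<close> were not reached by then, the equation
  would hold up to that time and force the path down to \<open>a\<close>.\<close>

lemma hit_le_of_descent:
  assumes p: "pm < 0" "0 < pp" and sol: "solves_until pm pp a x e"
    and v: "0 \<le> v" "x v \<le> b" and ab: "a \<le> b" and d: "1 \<le> d" "b = pm - d"
  shows "hit a x \<le> ereal (v + 4 * (b - a) / d\<^sup>2)"
proof (rule ccontr)
  let ?t = "v + 4 * (b - a) / d\<^sup>2"
  assume "\<not> ?thesis"
  then have hit: "ereal ?t \<le> hit a x" by simp
  have "0 \<le> 4 * (b - a) / d\<^sup>2" using ab by simp
  have "x ?t \<le> x v + (- (d\<^sup>2 / 4)) * (?t - v)"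
  \<comment> \<open>The margin 1/2 makes the start condition strict. It costs only a factor:
    \<open>d - 1 / 2\<close> is still at least \<open>d / 2\<close> because
    \<open>1 \<le> d\<close>.\<close>
  proof (rule solves_until_bound[OF sol v(1) _ hit, where b = "b + 1 / 2"])
    fix r assume "x r \<le> b + 1 / 2"
    then have "d / 2 \<le> - x r" "d / 2 \<le> pm - x r" "x r \<le> 0" using d p by auto
    then have "(d / 2) * (d / 2) \<le> (- x r) * (pm - x r)"
      using d by (intro mult_mono) auto
    then have "x r * (pm - x r) \<le> - (d\<^sup>2 / 4)" by (simp add: power2_eq_square)
    then show "vfield pm pp (e r) (x r) \<le> - (d\<^sup>2 / 4)"
      using vfield_le_of_nonpos[OF p \<open>x r \<le> 0\<close>, of "e r"] by linarith
  qed (use \<open>0 \<le> 4 * (b - a) / d\<^sup>2\<close> v(2) in \<open>auto simp: max_def\<close>)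
  also have "\<dots> = x v - (b - a)" using d by (simp add: field_simps)
  also have "\<dots> \<le> a" using v(2) by simp
  finally have "hit a x \<le> ereal ?t"
    using v(1) \<open>0 \<le> 4 * (b - a) / d\<^sup>2\<close> by (intro hit_le) auto
  with \<open>\<not> ?thesis\<close> show False by simp
qed

lemma hit_diff_less:
  assumes p: "pm < 0" "0 < pp" and sol: "solves_until pm pp a x e" and a: "a \<le> pm - 2"
    and fin: "hit (pm - 1) x < \<infinity>"
  shows "hit a x - hit (a + 1) x < ereal (5 / (pm - 1 - a)\<^sup>2)"
proof -
  have cont: "continuous_on {0..} x" using sol by (simp add: solves_until_def)
  obtain u where u: "0 \<le> u" "x u \<le> pm - 1"
    using hit_attained[OF cont fin] by metis
  \<comment> \<open>A crude descent from \<open>pm - 1\<close> with \<open>d = 1\<close> serves only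
    to make both hitting times finite. The sharp bound comes from the descent from
    \<open>a + 1\<close>, where \<open>d = pm - 1 - a\<close>.\<close>
  have "hit a x \<le> ereal (u + 4 * (pm - 1 - a) / 1\<^sup>2)"
    by (rule hit_le_of_descent[OF p sol u]) (use a in auto)
  then have "hit a x < \<infinity>" by (rule le_less_trans) simp
  then have "hit (a + 1) x < \<infinity>"
    using hit_antimono[of a "a + 1" x] by (intro le_less_trans[OF _ \<open>hit a x < \<infinity>\<close>]) simp
  then obtain v where v: "0 \<le> v" "hit (a + 1) x = ereal v" "x v \<le> a + 1"
    using hit_attained[OF cont] by metis
  obtain w where w: "hit a x = ereal w"
    using \<open>hit a x < \<infinity>\<close> hit_attained[OF cont] by metis
  have "hit a x \<le> ereal (v + 4 * (a + 1 - a) / (pm - 1 - a)\<^sup>2)"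
    by (rule hit_le_of_descent[OF p sol v(1,3)]) (use a in auto)
  then have "w - v \<le> 4 / (pm - 1 - a)\<^sup>2" using w by simp
  also have "\<dots> < 5 / (pm - 1 - a)\<^sup>2" using a by (intro divide_strict_right_mono) auto
  finally show ?thesis using w v(2) by simp
qed

text \<open>Two phases. Up to time \<open>s\<close> the path can rise by at most
  \<open>\<delta> / 4\<close> in any mode. Then mode 1 pushes it down at speed at least
  \<open>pp * \<delta> / 2\<close>, long enough to fall by \<open>1 - pm\<close>. Should
  \<open>a\<close> be hit on the way, the level \<open>pm - 1\<close> has been reached as
  well.\<close>

lemma hit_finite_of_long_stay:
  assumes p: "pm < 0" "0 < pp" and sol: "solves_until pm pp a x e" and a: "a \<le> pm - 1"
    and \<delta>: "0 < \<delta>" "x 0 \<le> - \<delta>"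
    and s: "0 \<le> s" "s \<le> \<delta> / (4 * pm\<^sup>2)"
    and stay: "\<And>r. r \<in> {s..s + 2 * (1 - pm) / (pp * \<delta>)} \<Longrightarrow> e r = 1"
  shows "hit (pm - 1) x < \<infinity>"
proof (cases "ereal (s + 2 * (1 - pm) / (pp * \<delta>)) \<le> hit a x")
  case False
  then have "hit a x < \<infinity>" by auto
  then show ?thesis using hit_antimono[OF a, of x] by (rule le_less_trans[rotated])
next
  case True
  define T where "T = 2 * (1 - pm) / (pp * \<delta>)"
  have "0 \<le> T" using p \<delta> by (simp add: T_def)
  have hit: "ereal (s + T) \<le> hit a x" using True by (simp add: T_def)
  have "ereal s \<le> ereal (s + T)" using \<open>0 \<le> T\<close> by simp
  then have hit_s: "ereal s \<le> hit a x" using hit by (rule order_trans)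
  have "pm\<^sup>2 * s \<le> \<delta> / 4" using s p by (simp add: field_simps)
  have "x s \<le> x 0 + pm\<^sup>2 * (s - 0)"
  proof (rule solves_until_bound[OF sol order_refl s(1) hit_s, where b = "- (\<delta> / 2)"])
    fix r assume r: "x r \<le> - (\<delta> / 2)"
    have "x r * (pm - x r) \<le> pm\<^sup>2"
    proof -
      \<comment> \<open>Completing the square bounds the upward drift uniformly in
        \<open>x r\<close>.\<close>
      have "pm\<^sup>2 - x r * (pm - x r) = (x r - pm / 2)\<^sup>2 + 3 / 4 * pm\<^sup>2"
        by (simp add: power2_eq_square algebra_simps)
      moreover have "0 \<le> (x r - pm / 2)\<^sup>2 + 3 / 4 * pm\<^sup>2" by simp
      ultimately show ?thesis by linarith
    qed
    with vfield_le_of_nonpos[OF p, of "x r" "e r"] r \<delta>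
    show "vfield pm pp (e r) (x r) \<le> pm\<^sup>2" by simp
  qed (use \<open>pm\<^sup>2 * s \<le> \<delta> / 4\<close> \<delta> in auto)
  then have xs: "x s \<le> - (3 * \<delta> / 4)" using \<open>pm\<^sup>2 * s \<le> \<delta> / 4\<close> \<delta> by simp
  have "x (s + T) \<le> x s + (- (pp * \<delta> / 2)) * (s + T - s)"
  proof (rule solves_until_bound[OF sol s(1) _ hit, where b = "- (\<delta> / 2)"])
    fix r assume r: "r \<in> {s..s + T}" "x r \<le> - (\<delta> / 2)"
    have "pp * x r \<le> pp * (- (\<delta> / 2))" using r(2) p by (intro mult_left_mono) auto
    moreover have "pp * x r - (x r)\<^sup>2 \<le> pp * x r" by simp
    ultimately have "pp * x r - (x r)\<^sup>2 \<le> - (pp * \<delta> / 2)" by linarith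
    then show "vfield pm pp (e r) (x r) \<le> - (pp * \<delta> / 2)"
      using stay[of r] r(1) by (simp add: vfield_def T_def)
  next
    show "x s + max (- (pp * \<delta> / 2)) 0 * (s + T - s) < - (\<delta> / 2)"
      using xs p \<delta> by (simp add: max_def)
  qed (use \<open>0 \<le> T\<close> in auto)
  also have "\<dots> = x s + (pm - 1)" using p \<delta> by (simp add: T_def field_simps)
  also have "\<dots> \<le> pm - 1" using xs \<delta> by simp
  finally have "hit (pm - 1) x \<le> ereal (s + T)" using s(1) \<open>0 \<le> T\<close> by (intro hit_le) auto
  then show ?thesis by (rule le_less_trans) simp
qed


section \<open>A long stay in mode 1 has positive probability\<close>

abbreviation exp_measure :: "real measure" where
  "exp_measure \<equiv> density lborel (exponential_density 1)"

lemma prob_space_exp_measure: "prob_space exp_measure"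
  by (rule prob_space_exponential_density) simp

lemma exp_measure_greaterThan:
  assumes "0 \<le> c"
  shows "measure exp_measure {c<..} = exp (- c)"
proof -
  interpret prob_space exp_measure by (rule prob_space_exp_measure)
  have "distributed exp_measure lborel (\<lambda>x. x) (exponential_density 1)"
    by (simp add: distributed_def distr_id2)
  from exponential_distributedD_gt[OF this assms]
  have "measure exp_measure {x \<in> space exp_measure. c < x} = exp (- c)" by simp
  moreover have "{x \<in> space exp_measure. c < x} = {c<..}" by auto
  ultimately show ?thesis by simp
qed

lemma exp_measure_interval_pos:
  assumes "0 < c"
  shows "0 < measure exp_measure {0<..c}"
proof -
  interpret prob_space exp_measure by (rule prob_space_exp_measure)
  have "measure exp_measure ({0<..} - {c<..}) =
      measure exp_measure {0<..} - measure exp_measure {c<..}"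
    using assms by (intro finite_measure_Diff) auto
  moreover have "{0<..} - {c<..} = {0<..c}" by auto
  ultimately show ?thesis using assms by (simp add: exp_measure_greaterThan)
qed

text \<open>Under the product measure the first two coordinates are independent, so the probability
  is a product of two positive factors.\<close>

lemma exp_sequence_cylinder_pos:
  assumes "0 < measure exp_measure A" "0 < measure exp_measure B" "A \<in> sets borel" "B \<in> sets borel"
  shows "0 < emeasure (Pi\<^sub>M UNIV (\<lambda>_::nat. exp_measure)) {u. u 0 \<in> A \<and> u 1 \<in> B}"
proof -
  interpret prob_space exp_measure by (rule prob_space_exp_measure)
  interpret P: product_prob_space "\<lambda>_::nat. exp_measure" UNIV ..
  define F where "F i = (if i = 0 then A else B)" for i :: nat
  have "emeasure (Pi\<^sub>M UNIV (\<lambda>_::nat. exp_measure))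
      {u \<in> space (Pi\<^sub>M UNIV (\<lambda>_::nat. exp_measure)). \<forall>i\<in>{0,1}. u i \<in> F i} =
      (\<Prod>i\<in>{0,1}. emeasure exp_measure (F i))"
    by (rule P.emeasure_PiM_Collect) (use assms in \<open>auto simp: F_def\<close>)
  also have "{u \<in> space (Pi\<^sub>M UNIV (\<lambda>_::nat. exp_measure)). \<forall>i\<in>{0,1}. u i \<in> F i} =
      {u. u 0 \<in> A \<and> u 1 \<in> B}"
    by (auto simp: F_def space_PiM)
  also have "(\<Prod>i\<in>{0::nat,1}. emeasure exp_measure (F i)) =
      emeasure exp_measure A * emeasure exp_measure B"
    by (simp add: F_def)
  finally show ?thesis using assms by (simp add: emeasure_eq_measure ennreal_zero_less_mult_iff)
qed

text \<open>Started in mode 1, a long first holding time suffices; started in mode -1, a short first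
  holding time followed by a long second one.\<close>

lemma long_stay_event:
  assumes rates: "0 < lm" "0 < lp" and "0 < c" "0 \<le> T" and "e \<in> modes"
  obtains A B where "A \<in> sets borel" "B \<in> sets borel"
    "0 < measure exp_measure A" "0 < measure exp_measure B"
    "\<And>u. u 0 \<in> A \<Longrightarrow> u 1 \<in> B \<Longrightarrow>
       \<exists>n. e * (-1) ^ n = 1 \<and> 0 \<le> jump_time lm lp e u n \<and> jump_time lm lp e u n \<le> c \<and>
         jump_time lm lp e u n + T < jump_time lm lp e u (Suc n)"
proof (cases "e = 1")
  case True
  show thesis
  proof (rule that[of "{lp * T<..}" "{0<..}"])
    fix u :: "nat \<Rightarrow> real" assume "u 0 \<in> {lp * T<..}"
    then have "T < u 0 / lp" using rates by (simp add: field_simps)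
    then show "\<exists>n. e * (-1) ^ n = 1 \<and> 0 \<le> jump_time lm lp e u n \<and> jump_time lm lp e u n \<le> c \<and>
         jump_time lm lp e u n + T < jump_time lm lp e u (Suc n)"
      using True assms by (intro exI[of _ 0]) (simp add: jump_time_def leave_rate_def)
  qed (use assms in \<open>auto simp: exp_measure_greaterThan\<close>)
next
  case False
  then have e: "e = -1" using \<open>e \<in> modes\<close> by (simp add: modes_def)
  show thesis
  proof (rule that[of "{0<..lm * c}" "{lp * T<..}"])
    fix u :: "nat \<Rightarrow> real" assume u: "u 0 \<in> {0<..lm * c}" "u 1 \<in> {lp * T<..}"
    then have "T < u 1 / lp" "0 < u 0 / lm" "u 0 / lm \<le> c" using rates by (simp_all add: field_simps)
    then show "\<exists>n. e * (-1) ^ n = 1 \<and> 0 \<le> jump_time lm lp e u n \<and> jump_time lm lp e u n \<le> c \<and>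
         jump_time lm lp e u n + T < jump_time lm lp e u (Suc n)"
      using e by (intro exI[of _ 1]) (simp add: jump_time_def leave_rate_def)
  qed (use assms in \<open>auto simp: exp_measure_greaterThan intro!: exp_measure_interval_pos\<close>)
qed

text \<open>The negative half line times the modes is a countable union of such sets with
  \<open>\<delta> = inverse (Suc n)\<close>; if all were null, their union could not have mass
  1.\<close>

lemma exists_negative_start:
  assumes "sets \<nu> = sets state_space" "emeasure \<nu> ({..<0} \<times> modes) = 1"
  shows "\<exists>\<delta> e. 0 < \<delta> \<and> e \<in> modes \<and> emeasure \<nu> ({..- \<delta>} \<times> {e}) > 0"
proof (rule ccontr)
  assume no: "\<not> ?thesis"
  define S where "S n e = {..- inverse (real (Suc n))} \<times> {e}" for n and e :: int
  have "S n e \<in> null_sets \<nu>" if "e \<in> modes" for n e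
  proof
    show "S n e \<in> sets \<nu>"
      unfolding S_def assms(1) state_space_def using that by (intro pair_measureI) auto
    show "emeasure \<nu> (S n e) = 0"
      unfolding S_def using no that
      by (metis inverse_positive_iff_positive of_nat_0_less_iff zero_less_Suc not_gr_zero)
  qed
  then have "(\<Union>e\<in>modes. \<Union>n. S n e) \<in> null_sets \<nu>"
    by (intro null_sets_UN' null_sets_UN) (auto simp: modes_def)
  moreover have "(\<Union>e\<in>modes. \<Union>n. S n e) = {..<0} \<times> modes"
  proof (intro equalityI subsetI)
    fix z assume "z \<in> {..<0::real} \<times> modes"
    then obtain y e where z: "z = (y, e)" "y < 0" "e \<in> modes" by auto
    obtain n where "inverse (real (Suc n)) < - y" using reals_Archimedean[of "- y"] z by auto
    then have "z \<in> S n e" using z by (auto simp: S_def)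
    then show "z \<in> (\<Union>e\<in>modes. \<Union>n. S n e)" using z by blast
  qed (auto simp: S_def intro: le_less_trans)
  ultimately show False using assms(2) by auto
qed

text \<open>The joint law of the initial state and the exponential variables is a product, so a good
  start and a good pair of holding times occur together with positive probability. On that event the
  deterministic descent applies almost surely.\<close>

lemma hit_finite_positive:
  assumes p: "pm < 0" "0 < pp" and rates: "0 < lm" "0 < lp"
    and \<nu>: "prob_space \<nu>" "sets \<nu> = sets state_space" "emeasure \<nu> ({..<0} \<times> modes) = 1"
    and a: "a \<le> pm - 1"
    and proc: "switching_process_until pm pp lm lp \<nu> a M X E"
  shows "0 < measure M {\<omega> \<in> space M. hit (pm - 1) (\<lambda>t. X t \<omega>) < \<infinity>}"
proof -
  interpret prob_space M using proc by (simp add: switching_process_until_def)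
  interpret N: prob_space exp_measure by (rule prob_space_exp_measure)
  interpret P: product_prob_space "\<lambda>_::nat. exp_measure" UNIV ..
  let ?Z = "\<lambda>\<omega>. (X 0 \<omega>, E 0 \<omega>)"
  let ?P = "Pi\<^sub>M UNIV (\<lambda>_::nat. exp_measure)"
  have ms: "markov_switching lm lp M ?Z E" and law: "distr M state_space ?Z = \<nu>"
    and X: "\<And>t. 0 \<le> t \<Longrightarrow> X t \<in> borel_measurable M"
      "\<And>\<omega>. \<omega> \<in> space M \<Longrightarrow> continuous_on {0..} (\<lambda>t. X t \<omega>)"
    and sol: "AE \<omega> in M. \<forall>t\<ge>0. ereal t \<le> hit a (\<lambda>s. X s \<omega>) \<longrightarrow>
        ((\<lambda>s. vfield pm pp (E s \<omega>) (X s \<omega>)) has_integral (X t \<omega> - X 0 \<omega>)) {0..t}"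
    using proc by (auto simp: switching_process_until_def)
  from ms obtain \<xi> where Zm: "?Z \<in> measurable M state_space"
    and \<xi>: "\<And>n. \<xi> n \<in> borel_measurable M"
    and joint: "distr M (state_space \<Otimes>\<^sub>M Pi\<^sub>M UNIV (\<lambda>_. borel)) (\<lambda>\<omega>. (?Z \<omega>, \<lambda>n. \<xi> n \<omega>)) =
      \<nu> \<Otimes>\<^sub>M ?P"
    and jumps: "AE \<omega> in M. \<forall>n t.
       jump_time lm lp (E 0 \<omega>) (\<lambda>k. \<xi> k \<omega>) n \<le> t \<and>
       t < jump_time lm lp (E 0 \<omega>) (\<lambda>k. \<xi> k \<omega>) (Suc n) \<longrightarrow> E t \<omega> = E 0 \<omega> * (-1) ^ n"
    unfolding markov_switching_def law by auto
  obtain \<delta> e where \<delta>: "0 < \<delta>" "e \<in> modes" and pos\<nu>: "emeasure \<nu> ({..- \<delta>} \<times> {e}) > 0"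
    using exists_negative_start[OF \<nu>(2,3)] by blast
  \<comment> \<open>\<open>c\<close> is the latest admissible beginning of the stay in mode 1 and
    \<open>T\<close> its required length, as in \<open>hit_finite_of_long_stay\<close>.\<close>
  define c where "c = \<delta> / (4 * pm\<^sup>2)"
  define T where "T = 2 * (1 - pm) / (pp * \<delta>)"
  have "0 < c" "0 \<le> T" using \<delta> p by (auto simp: c_def T_def)
  from long_stay_event[OF rates this \<delta>(2)]
  obtain A B where AB: "A \<in> sets borel" "B \<in> sets borel"
      "0 < measure exp_measure A" "0 < measure exp_measure B"
    and stay: "\<And>u. u 0 \<in> A \<Longrightarrow> u 1 \<in> B \<Longrightarrow>
       \<exists>n. e * (-1) ^ n = 1 \<and> 0 \<le> jump_time lm lp e u n \<and> jump_time lm lp e u n \<le> c \<and>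
         jump_time lm lp e u n + T < jump_time lm lp e u (Suc n)"
    by metis
  define S where "S = {..- \<delta>} \<times> {e}"
  define U where "U = {u :: nat \<Rightarrow> real. u 0 \<in> A \<and> u 1 \<in> B}"
  define G where "G = {\<omega> \<in> space M. ?Z \<omega> \<in> S \<and> (\<lambda>n. \<xi> n \<omega>) \<in> U}"
  have S: "S \<in> sets state_space"
    unfolding S_def state_space_def using \<delta> by (intro pair_measureI) auto
  have "U = {u \<in> space (Pi\<^sub>M UNIV (\<lambda>_. borel)). u 0 \<in> A \<and> u 1 \<in> B}"
    by (auto simp: U_def space_PiM)
  also have "\<dots> \<in> sets (Pi\<^sub>M UNIV (\<lambda>_. borel))" using AB(1,2) by measurable
  finally have U: "U \<in> sets (Pi\<^sub>M UNIV (\<lambda>_. borel))" .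
  have setsP: "sets ?P = sets (Pi\<^sub>M UNIV (\<lambda>_. borel))"
    by (intro sets_PiM_cong) auto
  have pair: "(\<lambda>\<omega>. (?Z \<omega>, \<lambda>n. \<xi> n \<omega>)) \<in> measurable M (state_space \<Otimes>\<^sub>M Pi\<^sub>M UNIV (\<lambda>_. borel))"
    using Zm \<xi> by (intro measurable_Pair measurable_PiM_single') auto
  have G_eq: "G = (\<lambda>\<omega>. (?Z \<omega>, \<lambda>n. \<xi> n \<omega>)) -` (S \<times> U) \<inter> space M"
    by (auto simp: G_def)
  have G: "G \<in> sets M"
    unfolding G_eq using S U by (intro measurable_sets[OF pair] pair_measureI)
  have "emeasure M G = emeasure (\<nu> \<Otimes>\<^sub>M ?P) (S \<times> U)"
    unfolding G_eq joint[symmetric] using S U by (subst emeasure_distr[OF pair]) auto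
  also have "\<dots> = emeasure \<nu> S * emeasure ?P U"
    using S U \<nu>(2) setsP by (intro P.emeasure_pair_measure_Times) auto
  also have "\<dots> > 0"
    using pos\<nu> exp_sequence_cylinder_pos[OF AB(3,4,1,2)]
    by (simp add: S_def U_def ennreal_zero_less_mult_iff)
  finally have "0 < measure M G" by (simp add: emeasure_eq_measure)
  also have "measure M G \<le> measure M {\<omega> \<in> space M. hit (pm - 1) (\<lambda>t. X t \<omega>) < \<infinity>}"
  proof (rule finite_measure_mono_AE)
    have [measurable]: "(\<lambda>\<omega>. hit (pm - 1) (\<lambda>t. X t \<omega>)) \<in> borel_measurable M"
      by (rule measurable_hit[OF X])
    show "{\<omega> \<in> space M. hit (pm - 1) (\<lambda>t. X t \<omega>) < \<infinity>} \<in> sets M" by measurable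
    show "AE \<omega> in M. \<omega> \<in> G \<longrightarrow> \<omega> \<in> {\<omega> \<in> space M. hit (pm - 1) (\<lambda>t. X t \<omega>) < \<infinity>}"
      using sol jumps AE_space
    proof eventually_elim
      case (elim \<omega>)
      show ?case
      proof
        assume "\<omega> \<in> G"
        then have \<omega>: "X 0 \<omega> \<le> - \<delta>" "E 0 \<omega> = e" "\<xi> 0 \<omega> \<in> A" "\<xi> 1 \<omega> \<in> B"
          by (auto simp: G_def S_def U_def)
        obtain n where n: "e * (-1) ^ n = 1"
          "0 \<le> jump_time lm lp e (\<lambda>k. \<xi> k \<omega>) n" "jump_time lm lp e (\<lambda>k. \<xi> k \<omega>) n \<le> c"
          "jump_time lm lp e (\<lambda>k. \<xi> k \<omega>) n + T < jump_time lm lp e (\<lambda>k. \<xi> k \<omega>) (Suc n)"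
          using stay[of "\<lambda>k. \<xi> k \<omega>"] \<omega>(3,4) by blast
        have sol\<omega>: "solves_until pm pp a (\<lambda>t. X t \<omega>) (\<lambda>t. E t \<omega>)"
          using elim(1) X(2)[OF elim(3)] by (simp add: solves_until_def)
        have "hit (pm - 1) (\<lambda>t. X t \<omega>) < \<infinity>"
        proof (rule hit_finite_of_long_stay[OF p sol\<omega> a \<delta>(1) \<omega>(1) n(2)])
          show "jump_time lm lp e (\<lambda>k. \<xi> k \<omega>) n \<le> \<delta> / (4 * pm\<^sup>2)" using n(3) by (simp add: c_def)
          fix r assume "r \<in> {jump_time lm lp e (\<lambda>k. \<xi> k \<omega>) n..
            jump_time lm lp e (\<lambda>k. \<xi> k \<omega>) n + 2 * (1 - pm) / (pp * \<delta>)}"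
          \<comment> \<open>The strict inequality for the next jump time places the closed interval
            inside the half-open holding interval.\<close>
          then have "jump_time lm lp e (\<lambda>k. \<xi> k \<omega>) n \<le> r" "r < jump_time lm lp e (\<lambda>k. \<xi> k \<omega>) (Suc n)"
            using n(4) by (auto simp: T_def)
          then show "E r \<omega> = 1" using elim(2) n(1) \<omega>(2) by metis
        qed
        then show "\<omega> \<in> {\<omega> \<in> space M. hit (pm - 1) (\<lambda>t. X t \<omega>) < \<infinity>}" using elim(3) by simp
      qed
    qed
  qed
  finally show ?thesis .
qed


section \<open>The stopped law\<close>

text \<open>Positivity of the condition excludes the default value 0 of the quotient defining the
  conditional probability.\<close>

lemma (in prob_space) cond_prob_eq_1:
  assumes "{x \<in> space M. Q x} \<in> events" "{x \<in> space M. R x \<and> Q x} \<in> events"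
    and "AE x in M. Q x \<longrightarrow> R x" "0 < prob {x \<in> space M. Q x}"
  shows "\<P>(x in M. R x \<bar> Q x) = 1"
proof -
  have "prob {x \<in> space M. R x \<and> Q x} = prob {x \<in> space M. Q x}"
    using assms(3) by (intro finite_measure_eq_AE) (use assms in auto)
  then show ?thesis using assms(4) by (simp add: cond_prob_def)
qed

text \<open>Reflection about \<open>c\<close> turns this into the integral of
  \<open>C / x\<^sup>2\<close> over \<open>{1..}\<close>, which equals \<open>C\<close>. For
  negative \<open>C\<close> the integrand is truncated to 0 by \<open>ennreal\<close>.\<close>

lemma nn_integral_inverse_square_tail:
  fixes c C :: real
  shows "(\<integral>\<^sup>+x\<in>{..c - 1}. ennreal (C / (c - x)\<^sup>2) \<partial>lborel) < \<infinity>"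
proof (cases "0 \<le> C")
  case True
  have "(\<integral>\<^sup>+x\<in>{..c - 1}. ennreal (C / (c - x)\<^sup>2) \<partial>lborel) =
      (\<integral>\<^sup>+x. ennreal (C / x\<^sup>2) * indicator {1..} x \<partial>lborel)"
    by (subst nn_integral_real_affine[where c = "-1" and t = c])
       (auto intro!: nn_integral_cong simp: indicator_def)
  also have "\<dots> = ennreal (0 - (- (C / 1)))"
  proof (rule nn_integral_FTC_atLeast)
    show "((\<lambda>x. - (C / x)) has_real_derivative C / x\<^sup>2) (at x)" if "1 \<le> x" for x
      using that by (auto intro!: derivative_eq_intros simp: power2_eq_square)
    show "((\<lambda>x. - (C / x)) \<longlongrightarrow> 0) at_top"
      using tendsto_minus[OF tendsto_divide_0[OF tendsto_const
        filterlim_at_top_imp_at_infinity[OF filterlim_ident]], of C] by simp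
  qed (use True in auto)
  finally show ?thesis by simp
next
  case False
  then have "ennreal (C / (c - x)\<^sup>2) = 0" for x by (simp add: ennreal_neg divide_nonpos_nonneg)
  then show ?thesis by simp
qed

theorem proposition3p6:
  fixes pm pp lm lp :: real and \<nu> :: "(real \<times> int) measure"
  assumes "pm < 0" and "0 < pp" and "0 < lm" and "0 < lp"
    and "prob_space \<nu>" and "sets \<nu> = sets state_space"
    and "emeasure \<nu> ({..<0} \<times> modes) = 1"
  shows "\<exists>g :: real \<Rightarrow> real.
    mono_on {..pm - 2} g \<and>
    (\<forall>a\<le>pm - 2. 0 < g a) \<and>
    (\<integral>\<^sup>+a\<in>{..pm - 2}. ennreal (g a) \<partial>lborel) < \<infinity> \<and>
    (\<forall>a\<le>pm - 2. \<forall>(M :: 'w measure) X E.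
       switching_process_until pm pp lm lp \<nu> a M X E \<longrightarrow>
       \<P>(w in stopped_law M X E a. path_hit (pm - 1) w < \<infinity>) > 0 \<and>
       \<P>(w in stopped_law M X E a. path_hit a w - path_hit (a + 1) w < ereal (g a)
            \<bar> path_hit (pm - 1) w < \<infinity>) = 1)"
\<comment> \<open>\<open>pm - 1 - a\<close> is the depth of \<open>a + 1\<close> below
  \<open>pm\<close>, and is at least 1 on the domain of \<open>g\<close>.\<close>
proof (intro exI[of _ "\<lambda>a. 5 / (pm - 1 - a)\<^sup>2"] conjI allI impI)
  show "mono_on {..pm - 2} (\<lambda>a. 5 / (pm - 1 - a)\<^sup>2)"
    by (intro mono_onI divide_left_mono power_mono mult_pos_pos) auto
  show "0 < 5 / (pm - 1 - a)\<^sup>2" if "a \<le> pm - 2" for a using that by simp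
  show "(\<integral>\<^sup>+a\<in>{..pm - 2}. ennreal (5 / (pm - 1 - a)\<^sup>2) \<partial>lborel) < \<infinity>"
    using nn_integral_inverse_square_tail[where c = "pm - 1" and C = 5] by simp
  fix a and M :: "'w measure" and X E
  assume a: "a \<le> pm - 2" and proc: "switching_process_until pm pp lm lp \<nu> a M X E"
  interpret prob_space M using proc by (simp add: switching_process_until_def)
  let ?L = "stopped_law M X E a"
  let ?p = "stopped_path X E a"
  have X: "\<And>t. 0 \<le> t \<Longrightarrow> X t \<in> borel_measurable M"
      "\<And>\<omega>. \<omega> \<in> space M \<Longrightarrow> continuous_on {0..} (\<lambda>t. X t \<omega>)"
    and E: "\<And>t. 0 \<le> t \<Longrightarrow> E t \<in> measurable M (count_space modes)"
      "\<And>\<omega> t. \<omega> \<in> space M \<Longrightarrow> 0 \<le> t \<Longrightarrow> continuous (at_right t) (\<lambda>s. E s \<omega>)"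
    and sol: "AE \<omega> in M. \<forall>t\<ge>0. ereal t \<le> hit a (\<lambda>s. X s \<omega>) \<longrightarrow>
        ((\<lambda>s. vfield pm pp (E s \<omega>) (X s \<omega>)) has_integral (X t \<omega> - X 0 \<omega>)) {0..t}"
    using proc by (auto simp: switching_process_until_def markov_switching_def)
  have path [measurable]: "?p \<in> measurable M path_space"
    by (rule measurable_stopped_path[OF X E])
  have L: "?L = distr M path_space ?p"
    by (simp add: stopped_law_def stopped_path_def[abs_def])
  interpret L: prob_space ?L unfolding L by (rule prob_space_distr) fact
  have [measurable_cong]: "sets ?L = sets path_space" by (simp add: L)
  \<comment> \<open>All levels involved, \<open>a\<close>, \<open>a + 1\<close> and
    \<open>pm - 1\<close>, are at least \<open>a\<close>, so stopping does not change their hitting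
    times.\<close>
  have hit_path: "path_hit b (?p \<omega>) = hit b (\<lambda>t. X t \<omega>)" if "\<omega> \<in> space M" "a \<le> b" for b \<omega>
    using X(2)[OF that(1)] that(2) by (rule path_hit_stopped_path)
  have "L.prob {w \<in> space ?L. path_hit (pm - 1) w < \<infinity>} =
      measure M {\<omega> \<in> space M. path_hit (pm - 1) (?p \<omega>) < \<infinity>}"
    unfolding L
    by (subst measure_distr)
       (use measurable_space[OF path] in \<open>auto intro!: arg_cong[where f = "measure M"]\<close>)
  also have "{\<omega> \<in> space M. path_hit (pm - 1) (?p \<omega>) < \<infinity>} =
      {\<omega> \<in> space M. hit (pm - 1) (\<lambda>t. X t \<omega>) < \<infinity>}"
    using hit_path[of _ "pm - 1"] a by auto
  also have "0 < measure M \<dots>"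
    by (rule hit_finite_positive[OF assms _ proc]) (use a in simp)
  finally show pos: "0 < L.prob {w \<in> space ?L. path_hit (pm - 1) w < \<infinity>}" .
  show "\<P>(w in ?L. path_hit a w - path_hit (a + 1) w < ereal (5 / (pm - 1 - a)\<^sup>2)
      \<bar> path_hit (pm - 1) w < \<infinity>) = 1"
  proof (rule L.cond_prob_eq_1[OF _ _ _ pos])
    have "AE \<omega> in M. path_hit (pm - 1) (?p \<omega>) < \<infinity> \<longrightarrow>
      path_hit a (?p \<omega>) - path_hit (a + 1) (?p \<omega>) < ereal (5 / (pm - 1 - a)\<^sup>2)"
      using sol AE_space
    proof eventually_elim
      case (elim \<omega>)
      then have "solves_until pm pp a (\<lambda>t. X t \<omega>) (\<lambda>t. E t \<omega>)"
        using X(2) by (simp add: solves_until_def)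
      from hit_diff_less[OF assms(1,2) this a] show ?case
        using hit_path[OF elim(2)] a by simp
    qed
    then show "AE w in ?L. path_hit (pm - 1) w < \<infinity> \<longrightarrow>
      path_hit a w - path_hit (a + 1) w < ereal (5 / (pm - 1 - a)\<^sup>2)"
      unfolding L by (subst AE_distr_iff) auto
  qed measurable
qed

end
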